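(* For any not necessarily finitely generated free group $\mathbf{F}$, there exists a projective plane $\Gamma$ such that $\mathbf{F} \leq \mathrm{Aut}(\Gamma)$, and $\mathbf{F}$ acts sharply transitively on the points of $\Gamma$.
   Context: A projective plane is an axiomatic (not necessarily Desarguesian) projective plane; $\mathrm{Aut}(\Gamma)$ is its group of automorphisms (collineations). A group acts sharply transitively on a set if for any two elements $x,y$ of the set there is exactly one group element mapping $x$ to $y$. The notation $\mathbf{F} \leq \mathrm{Aut}(\Gamma)$ means that $\mathbf{F}$ is isomorphic to a subgroup of $\mathrm{Aut}(\Gamma)$, with the action being that of this subgroup.
   Formalization: The free group is assumed nontrivial: the free group of rank 0 is the trivial group, which cannot act transitively on the points of a projective plane, since a plane has at least seven points. *)

theory Defs
  imports "HOL-Algebra.Algebra"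
begin

section \<open>Free groups\<close>

text \<open>A letter \<open>(s, True)\<close> stands for the generator \<open>s\<close>, and \<open>(s, False)\<close> for its formal inverse.\<close>

definition reduced_words :: "'a set \<Rightarrow> ('a \<times> bool) list set" where
  "reduced_words S =
    {w. fst ` set w \<subseteq> S \<and> successively (\<lambda>(a, d) (b, e). \<not> (a = b \<and> d \<noteq> e)) w}"

definition letter_val :: "('a, 'm) monoid_scheme \<Rightarrow> 'a \<times> bool \<Rightarrow> 'a" where
  "letter_val G l = (if snd l then fst l else inv\<^bsub>G\<^esub> (fst l))"

definition word_val :: "('a, 'm) monoid_scheme \<Rightarrow> ('a \<times> bool) list \<Rightarrow> 'a" where
  "word_val G w = foldr (\<lambda>l x. letter_val G l \<otimes>\<^bsub>G\<^esub> x) w \<one>\<^bsub>G\<^esub>"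

text \<open>\<open>G\<close> is free on \<open>S\<close> if every element is the value of exactly one reduced word in
  the elements of \<open>S\<close> and their inverses. The basis may be of any cardinality, including \<open>0\<close>.\<close>

definition free_basis :: "('a, 'm) monoid_scheme \<Rightarrow> 'a set \<Rightarrow> bool" where
  "free_basis G S \<longleftrightarrow>
    S \<subseteq> carrier G \<and> bij_betw (word_val G) (reduced_words S) (carrier G)"

locale free_group = group G for G (structure) +
  assumes ex_free_basis: "\<exists>S. free_basis G S"

section \<open>Projective planes and their collineations\<close>

text \<open>Lines are identified with the sets of points incident with them. The last axiom is the
  usual non-degeneracy condition: there are four points no three of which are collinear.\<close>

locale projective_plane =
  fixes P :: "'p set" and L :: "'p set set"
  assumes line_subset: "l \<in> L \<Longrightarrow> l \<subseteq> P"
    and unique_line: "\<lbrakk>x \<in> P; y \<in> P; x \<noteq> y\<rbrakk> \<Longrightarrow> \<exists>!l. l \<in> L \<and> x \<in> l \<and> y \<in> l"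
    and unique_point: "\<lbrakk>l \<in> L; m \<in> L; l \<noteq> m\<rbrakk> \<Longrightarrow> \<exists>!x. x \<in> P \<and> x \<in> l \<and> x \<in> m"
    and quadrangle: "\<exists>Q \<subseteq> P. card Q = 4 \<and> (\<forall>l \<in> L. card (Q \<inter> l) \<le> 2)"

text \<open>A collineation is a permutation of the points that induces a permutation of the lines;
  as in \<^const>\<open>BijGroup\<close>, it is required to be \<^const>\<open>undefined\<close> outside \<open>P\<close>.\<close>

definition collineations :: "'p set \<Rightarrow> 'p set set \<Rightarrow> ('p \<Rightarrow> 'p) set" where
  "collineations P L = {f \<in> Bij P. (\<lambda>l. f ` l) ` L = L}"

definition Aut :: "'p set \<Rightarrow> 'p set set \<Rightarrow> ('p \<Rightarrow> 'p) monoid" where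
  "Aut P L = (BijGroup P)\<lparr>carrier := collineations P L\<rparr>"

lemma (in projective_plane) group_Aut: "group (Aut P L)"
proof -
  have compose_image: "compose P f g ` l = f ` g ` l" if "l \<in> L" for f g :: "'p \<Rightarrow> 'p" and l
    using line_subset[OF that] by (auto simp: compose_def image_iff subset_iff)
  have "subgroup (collineations P L) (BijGroup P)"
  proof (rule group.subgroupI[OF group_BijGroup])
    show "collineations P L \<subseteq> carrier (BijGroup P)"
      by (auto simp: collineations_def BijGroup_def)
    have "(\<lambda>x\<in>P. x) ` l = l" if "l \<in> L" for l
      using line_subset[OF that] by (auto simp: image_iff subset_iff)
    then have "(\<lambda>x\<in>P. x) \<in> collineations P L"
      by (simp add: collineations_def id_Bij)
    then show "collineations P L \<noteq> {}" by blast
  next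
    fix f assume f: "f \<in> collineations P L"
    then have fB: "f \<in> Bij P" and fL: "(\<lambda>l. f ` l) ` L = L"
      by (auto simp: collineations_def)
    let ?g = "\<lambda>x\<in>P. inv_into P f x"
    have inv: "?g ` f ` l = l" if "l \<in> L" for l
    proof -
      have "?g (f x) = x" if "x \<in> l" for x
        using fB line_subset[OF \<open>l \<in> L\<close>] that
        by (auto simp: Bij_def bij_betw_def subset_iff)
      then show ?thesis by (simp only: image_image image_cong[OF refl, of l "\<lambda>x. ?g (f x)" id] id_apply image_id)
    qed
    have "(\<lambda>l. ?g ` l) ` L = (\<lambda>l. ?g ` l) ` (\<lambda>l. f ` l) ` L"
      using fL by simp
    also have "\<dots> = L"
      using inv by (simp add: image_image)
    finally show "inv\<^bsub>BijGroup P\<^esub> f \<in> collineations P L"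
      using fB by (simp add: inv_BijGroup collineations_def restrict_inv_into_Bij)
  next
    fix f g assume "f \<in> collineations P L" "g \<in> collineations P L"
    then have fB: "f \<in> Bij P" and fL: "(\<lambda>l. f ` l) ` L = L"
      and gB: "g \<in> Bij P" and gL: "(\<lambda>l. g ` l) ` L = L"
      by (auto simp: collineations_def)
    have "(\<lambda>l. compose P f g ` l) ` L = (\<lambda>l. f ` l) ` (\<lambda>l. g ` l) ` L"
      by (auto simp: compose_image image_image)
    then show "f \<otimes>\<^bsub>BijGroup P\<^esub> g \<in> collineations P L"
      using fB gB fL gL by (simp add: BijGroup_def collineations_def compose_Bij)
  qed
  then show ?thesis
    unfolding Aut_def by (rule subgroup.subgroup_is_group) (rule group_BijGroup)
qed

definition sharply_transitive :: "('p \<Rightarrow> 'p) set \<Rightarrow> 'p set \<Rightarrow> bool" where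
  "sharply_transitive H P \<longleftrightarrow> (\<forall>x\<in>P. \<forall>y\<in>P. \<exists>!h. h \<in> H \<and> h x = y)"

end

theory Submission
  imports Defs
begin

text \<open>Identify the points with the elements of the free group, on which the group acts by left
multiplication, and let the lines be the left translates \<open>g <# D\<close> of a single set \<open>D\<close>. The action on
the points is then sharply transitive by construction and preserves the lines. The incidence axioms
translate into a property of \<open>D\<close>: two points lie on exactly one line if every \<open>h \<noteq> \<one>\<close> is
\<open>inv a \<otimes> b\<close> for exactly one pair of elements of \<open>D\<close>, and two lines meet in exactly one point if every
\<open>h \<noteq> \<one>\<close> is \<open>a \<otimes> inv b\<close> for exactly one pair (\<open>projective_plane_translates\<close>). Both uniqueness
requirements amount to the same Sidon condition.

Such a \<open>D\<close> is built by transfinite recursion of length \<open>|G|\<close> (\<open>ex_sidon_all_differences\<close>). Before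
each stage the part \<open>D\<close> built so far is a Sidon set with fewer than \<open>|G|\<close> elements. If \<open>h\<close> is not yet a
left difference of \<open>D\<close>, the elements \<open>x\<close> and \<open>x \<otimes> h\<close> are added, and symmetrically for right
differences. The Sidon condition persists (\<open>sidon_insert_pair\<close>) provided that \<open>h\<close> is not an involution
and that \<open>x\<close> avoids the equations \<open>x = b\<close>, \<open>x \<otimes> a \<otimes> x = b\<close> and \<open>x \<otimes> a \<otimes> inv x = b\<close>, with \<open>a\<close> and
\<open>b\<close> from a set \<open>B\<close> of fewer than \<open>|G|\<close> parameters.

For a free group such an \<open>x\<close> exists (\<open>ex_generic\<close>). If \<open>B\<close> is infinite, some basis element occurs in no
element of \<open>B\<close>, by cardinality, and it can serve as \<open>x\<close>. If \<open>B\<close> is finite and \<open>p\<close>, \<open>q\<close> are distinct basis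
elements, then the product of the \<open>N\<close>-th powers of \<open>p\<close> and \<open>q\<close> works for large \<open>N\<close>: exponent sums exclude
the first two equations, and cancellation cannot shift the step from \<open>p\<close> to \<open>q\<close> in the middle of the
word, which excludes the third. In rank one the group is commutative, the third equation is harmless,
and a large power of the generator suffices.\<close>

unbundle cardinal_syntax

section \<open>Greedy constructions of transfinite length\<close>

text \<open>The tasks are handled along a well-order of type \<open>|T|\<close>, so that the set built before a given
stage is a union of fewer than \<open>|T|\<close> finite sets and hence is still smaller than \<open>T\<close>. This is what
makes \<open>step\<close> applicable at every stage, limit stages included; \<open>finitary\<close> carries goodness through
unions of chains.\<close>

lemma greedy_transfinite_union:
  fixes T :: "'t set" and good :: "'a set \<Rightarrow> bool" and met :: "'t \<Rightarrow> 'a set \<Rightarrow> bool"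
  assumes inf: "infinite T"
    and finitary: "\<And>D. \<forall>W. finite W \<longrightarrow> W \<subseteq> D \<longrightarrow> (\<exists>D'. good D' \<and> W \<subseteq> D') \<Longrightarrow> good D"
    and empty: "good {}"
    and mono: "\<And>t D D'. met t D \<Longrightarrow> D \<subseteq> D' \<Longrightarrow> met t D'"
    and step: "\<And>t D. t \<in> T \<Longrightarrow> good D \<Longrightarrow> |D| <o |T| \<Longrightarrow>
                 \<exists>E. finite E \<and> good (D \<union> E) \<and> met t (D \<union> E)"
  shows "\<exists>D. good D \<and> (\<forall>t\<in>T. met t D)"
proof -
  let ?r = "|T|"
  define R where "R = ?r - Id"
  have wo: "Well_order ?r" and co: "Card_order ?r" and field: "Field ?r = T"
    by simp_all
  have wfR: "wf R"
    using wo by (simp add: R_def well_order_on_def)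
  have less_iff: "s \<in> underS ?r t \<longleftrightarrow> (s, t) \<in> R" for s t
    by (auto simp: underS_def R_def)
  have transR: "trans R"
    unfolding R_def using wo
    by (simp add: well_order_on_def linear_order_on_def partial_order_on_def preorder_on_def
        trans_diff_Id)
  have totalR: "(s, t) \<in> R \<or> s = t \<or> (t, s) \<in> R" if "s \<in> T" "t \<in> T" for s t
    using wo that field
    by (auto simp: R_def well_order_on_def linear_order_on_def total_on_def)
  have RT: "s \<in> T" if "(s, t) \<in> R" for s t
    using that field by (auto simp: R_def Field_def)
  \<comment> \<open>Given the finite sets already added before stage t, pick a finite set that
    settles task t.\<close>
  define F where "F = (\<lambda>f t. SOME E. finite E \<and>
      good (\<Union>(f ` underS ?r t) \<union> E) \<and> met t (\<Union>(f ` underS ?r t) \<union> E))"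
  define E where "E = wfrec R F"
  define D where "D t = \<Union>(E ` underS ?r t)" for t
  have E_eq: "E t = (SOME W. finite W \<and> good (D t \<union> W) \<and> met t (D t \<union> W))" for t
  proof -
    have "cut E R t ` underS ?r t = E ` underS ?r t"
      by (rule image_cong) (auto simp: less_iff cut_apply)
    then show ?thesis
      unfolding D_def E_def by (subst wfrec[OF wfR]) (simp add: F_def)
  qed
  let ?U = "\<lambda>t. D t \<union> E t"
  have U_mono: "?U s \<subseteq> D t" if "(s, t) \<in> R" for s t
  proof -
    have "underS ?r s \<subseteq> underS ?r t" and "s \<in> underS ?r t"
      using that transD[OF transR] by (auto simp: less_iff)
    then show ?thesis unfolding D_def by blast
  qed
  have good_Union: "good (\<Union>(?U ` A))" if "A \<subseteq> T" and good_U: "\<And>s. s \<in> A \<Longrightarrow> good (?U s)" for A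
  proof (rule finitary, intro allI impI)
    fix W assume W: "finite W" "W \<subseteq> \<Union>(?U ` A)"
    show "\<exists>D'. good D' \<and> W \<subseteq> D'"
    proof (cases "A = {}")
      case True
      with W empty show ?thesis by auto
    next
      case False
      have comparable: "?U s \<subseteq> ?U t \<or> ?U t \<subseteq> ?U s" if "s \<in> A" "t \<in> A" for s t
      proof -
        have "(s, t) \<in> R \<or> s = t \<or> (t, s) \<in> R" using totalR that \<open>A \<subseteq> T\<close> by auto
        with U_mono[of s t] U_mono[of t s] show ?thesis by auto
      qed
      then have "subset.chain UNIV (?U ` A)"
        unfolding subset_chain_def by auto
      moreover have "?U ` A \<noteq> {}" using False by simp
      ultimately obtain B where "B \<in> ?U ` A" "W \<subseteq> B"
        using finite_subset_Union_chain[OF W] by metis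
      then show ?thesis using good_U by auto
    qed
  qed
  have D_eq: "D t = \<Union>(?U ` underS ?r t)" for t
  proof
    show "D t \<subseteq> \<Union>(?U ` underS ?r t)" unfolding D_def by blast
    show "\<Union>(?U ` underS ?r t) \<subseteq> D t"
      by (rule UN_least) (simp only: U_mono less_iff)
  qed
  have main: "t \<in> T \<longrightarrow> finite (E t) \<and> good (?U t) \<and> met t (?U t)" for t
  proof (induction t rule: wf_induct_rule[OF wfR])
    case (1 t)
    show ?case
    proof
      assume t: "t \<in> T"
      have IH: "finite (E s)" "good (?U s)" if "s \<in> underS ?r t" for s
        using 1 that RT unfolding less_iff by blast+
      have "good (D t)"
        by (subst D_eq, rule good_Union) (use IH RT less_iff in blast)+
      moreover have "|D t| <o ?r"
      proof (cases "finite (underS ?r t)")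
        case True
        then have "finite (D t)" unfolding D_def using IH by blast
        then show ?thesis using inf by (simp)
      next
        case False
        \<comment> \<open>A union of finite sets over an infinite index set is no larger than
          the index set.\<close>
        have "|D t| \<le>o |underS ?r t|"
          unfolding D_def using False IH
          by (intro card_of_UNION_ordLeq_infinite)
            (auto intro: ordLess_imp_ordLeq finite_ordLess_infinite2)
        also have "|underS ?r t| <o ?r"
          using card_of_underS[OF co] t field by blast
        finally show ?thesis .
      qed
      ultimately have "\<exists>E. finite E \<and> good (D t \<union> E) \<and> met t (D t \<union> E)"
        by (rule step[OF t])
      from someI_ex[OF this] show "finite (E t) \<and> good (?U t) \<and> met t (?U t)"
        unfolding E_eq[symmetric] .
    qed
  qed
  have "good (\<Union>(?U ` T))" by (rule good_Union) (use main in auto)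
  moreover have "met t (\<Union>(?U ` T))" if "t \<in> T" for t
    by (rule mono[of t "?U t"]) (use main that in auto)
  ultimately show ?thesis by blast
qed

section \<open>Sidon sets in groups\<close>

text \<open>Every equation that the extension step has to exclude involves at most four elements of the set
built so far, so a set of fourfold products captures all of them. It has to stay small.\<close>

lemma product4_ordLess:
  assumes inf: "infinite T" and A: "|A| <o |T|"
  shows "|(\<lambda>(p, q, r, s). f p q r s) ` (A \<times> A \<times> A \<times> A)| <o |T|"
proof (cases "finite A")
  case True
  then show ?thesis using inf by (simp)
next
  case False
  then have "|A \<times> A \<times> A \<times> A| \<le>o |A|"
    by (intro card_of_Times_ordLeq_infinite_Field) auto
  with A card_of_image show ?thesis by (meson ordLeq_ordLess_trans ordLeq_transitive)
qed

context group
begin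

text \<open>The property says that a non-trivial left difference \<open>inv a \<otimes> b\<close> has only one representation over
\<open>D\<close>, and that the same is true of the right differences \<open>a \<otimes> inv b\<close>. One condition serves both: an
equation \<open>a \<otimes> inv b \<otimes> c = d\<close> is a coincidence \<open>inv b \<otimes> c = inv a \<otimes> d\<close> of left differences and a
coincidence \<open>a \<otimes> inv b = d \<otimes> inv c\<close> of right differences, and the two trivial solutions are
\<open>a = b\<close> (with \<open>c = d\<close>) and \<open>b = c\<close> (with \<open>a = d\<close>).\<close>

definition sidon :: "'a set \<Rightarrow> bool" where
  "sidon D \<longleftrightarrow> D \<subseteq> carrier G \<and>
     (\<forall>a\<in>D. \<forall>b\<in>D. \<forall>c\<in>D. a \<otimes> inv b \<otimes> c \<in> D \<longrightarrow> a = b \<or> b = c)"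

definition left_difference :: "'a \<Rightarrow> 'a set \<Rightarrow> bool" where
  "left_difference h D \<longleftrightarrow> (\<exists>a\<in>D. \<exists>b\<in>D. h = inv a \<otimes> b)"

definition right_difference :: "'a \<Rightarrow> 'a set \<Rightarrow> bool" where
  "right_difference h D \<longleftrightarrow> (\<exists>a\<in>D. \<exists>b\<in>D. h = a \<otimes> inv b)"

text \<open>For a generic \<open>x\<close> none of the equations \<open>x = b\<close>, \<open>x \<otimes> a \<otimes> x = b\<close>, \<open>x \<otimes> a \<otimes> inv x = b\<close> with
parameters in \<open>B\<close> holds, apart from the unavoidable case \<open>a = \<one>\<close> of the last one. In a commutative
group the last equation just says \<open>a = b\<close>, and no \<open>x\<close> can avoid it; there it is harmless.\<close>

definition generic :: "'a set \<Rightarrow> 'a \<Rightarrow> bool" where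
  "generic B x \<longleftrightarrow> x \<notin> B \<and> (\<forall>a\<in>B. x \<otimes> a \<otimes> x \<notin> B) \<and>
     (\<forall>a\<in>B. x \<otimes> a \<otimes> inv x \<in> B \<longrightarrow> a = \<one> \<or> comm_group G)"

lemma sidonD:
  assumes "sidon D" "a \<in> D" "b \<in> D" "c \<in> D" "a \<otimes> inv b \<otimes> c \<in> D"
  shows "a = b \<or> b = c"
  using assms unfolding sidon_def by blast

lemma sidon_carrier: "sidon D \<Longrightarrow> a \<in> D \<Longrightarrow> a \<in> carrier G"
  unfolding sidon_def by blast

text \<open>Together with associativity these rules let the simplifier decide identities between group words.\<close>

lemma mult_inv_cancel_left:
  "\<lbrakk>x \<in> carrier G; y \<in> carrier G\<rbrakk> \<Longrightarrow> x \<otimes> (inv x \<otimes> y) = y"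
  "\<lbrakk>x \<in> carrier G; y \<in> carrier G\<rbrakk> \<Longrightarrow> inv x \<otimes> (x \<otimes> y) = y"
  by (simp_all add: m_assoc[symmetric])

lemmas word_simps = m_assoc mult_inv_cancel_left inv_mult_group

lemma solve_first:
  assumes "a \<in> carrier G" "b \<in> carrier G" "c \<in> carrier G" "d \<in> carrier G"
  shows "a \<otimes> inv b \<otimes> c = d \<longleftrightarrow> d \<otimes> inv c \<otimes> b = a"
  using assms by (auto simp: word_simps)

lemma solve_last:
  assumes "a \<in> carrier G" "b \<in> carrier G" "c \<in> carrier G" "d \<in> carrier G"
  shows "a \<otimes> inv b \<otimes> c = d \<longleftrightarrow> b \<otimes> inv a \<otimes> d = c"
  using assms by (auto simp: word_simps)

lemma solve_middle:
  assumes "a \<in> carrier G" "b \<in> carrier G" "c \<in> carrier G" "d \<in> carrier G"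
  shows "a \<otimes> inv b \<otimes> c = d \<longleftrightarrow> c \<otimes> inv d \<otimes> a = b"
  using assms solve_first[of a b c d] solve_last[of d c b a] by simp

text \<open>The relation \<open>a \<otimes> inv b \<otimes> c = d\<close> can be solved for each of its four letters, with a right-hand side
of the same shape. So a non-trivial relation in which \<open>z\<close> occurs once makes \<open>z\<close> a value
\<open>a \<otimes> inv b \<otimes> c\<close>. In a non-trivial relation \<open>z\<close> can occur twice only in positions \<open>a\<close>, \<open>c\<close> or in
positions \<open>b\<close>, \<open>d\<close>, and then the relation can be brought to the form \<open>z \<otimes> inv b \<otimes> z \<in> D\<close>.\<close>

lemma sidon_insert:
  assumes D: "sidon D" and z: "z \<in> carrier G"
    and fresh: "\<And>a b c. \<lbrakk>a \<in> D; b \<in> D; c \<in> D\<rbrakk> \<Longrightarrow> a \<otimes> inv b \<otimes> c \<noteq> z"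
    and fresh2: "\<And>b. b \<in> D \<Longrightarrow> z \<otimes> inv b \<otimes> z \<notin> D"
  shows "sidon (insert z D)"
  unfolding sidon_def
proof (intro conjI ballI impI)
  note car = sidon_carrier[OF D]
  show "insert z D \<subseteq> carrier G" using z car by auto
  fix a b c assume mem: "a \<in> insert z D" "b \<in> insert z D" "c \<in> insert z D"
    and "a \<otimes> inv b \<otimes> c \<in> insert z D"
  then obtain d where d: "d \<in> insert z D" and eq: "a \<otimes> inv b \<otimes> c = d" by blast
  have C: "a \<in> carrier G" "b \<in> carrier G" "c \<in> carrier G" "d \<in> carrier G"
    using mem d z car by auto
  have eqs: "d \<otimes> inv c \<otimes> b = a" "b \<otimes> inv a \<otimes> d = c" "c \<otimes> inv d \<otimes> a = b"
    using eq solve_first[OF C] solve_last[OF C] solve_middle[OF C] by simp_all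
  show "a = b \<or> b = c"
  proof (rule ccontr)
    assume ne: "\<not> (a = b \<or> b = c)"
    have "d \<noteq> a"
    proof
      assume "d = a"
      then have "c = b" using eqs(2) C by (simp add: word_simps)
      with ne show False by simp
    qed
    moreover have "d \<noteq> c"
    proof
      assume "d = c"
      then have "b = a" using eqs(1) C by (simp add: word_simps)
      with ne show False by simp
    qed
    moreover have "d \<notin> D" if "a \<in> D" "b \<in> D" "c \<in> D"
      using sidonD[OF D that] eq ne by auto
    ultimately show False
      using mem d ne eq eqs fresh fresh2 by (elim insertE) auto
  qed
qed

text \<open>The pair \<open>x\<close>, \<open>x \<otimes> h\<close> has the left difference \<open>h\<close>. Both insertions are justified by
\<open>sidon_insert\<close>: each bad relation either reduces to an equation that a generic \<open>x\<close> does not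
satisfy, or contradicts the hypotheses on \<open>h\<close>. The only relation leading to a conjugation is
\<open>a \<otimes> inv b \<otimes> x = x \<otimes> h\<close>; in a commutative group it makes \<open>h\<close> a left difference of \<open>D\<close>, which is
excluded. The hypothesis \<open>h \<otimes> h \<noteq> \<one>\<close> is needed because an involution \<open>h = inv a \<otimes> b\<close> would also be
the left difference \<open>inv b \<otimes> a\<close>.\<close>

lemma sidon_insert_pair:
  assumes D: "sidon D" and h: "h \<in> carrier G" "h \<otimes> h \<noteq> \<one>"
    and new: "\<not> left_difference h D"
    and x: "x \<in> carrier G" and gen: "generic B x"
    and A: "A = D \<union> m_inv G ` D \<union> {\<one>, h, inv h}"
    and B: "\<And>p q r s. \<lbrakk>p \<in> A; q \<in> A; r \<in> A; s \<in> A\<rbrakk> \<Longrightarrow> p \<otimes> q \<otimes> r \<otimes> s \<in> B"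
  shows "sidon (insert (x \<otimes> h) (insert x D))"
proof -
  note car = sidon_carrier[OF D]
  have AI: "a \<in> A" "inv a \<in> A" if "a \<in> D" for a using that A by auto
  have hA: "h \<in> A" "inv h \<in> A" and oneA: "\<one> \<in> A" using A by auto
  have AC: "a \<in> carrier G" if "a \<in> A" for a using that A h car by auto
  have B3: "p \<otimes> q \<otimes> r \<in> B" if "p \<in> A" "q \<in> A" "r \<in> A" for p q r
    using B[OF that oneA] that AC by simp
  have B2: "p \<otimes> q \<in> B" if "p \<in> A" "q \<in> A" for p q
    using B3[OF that oneA] that AC by simp
  have B1: "p \<in> B" if "p \<in> A" for p
    using B2[OF that oneA] that AC by simp
  have xB: "x \<noteq> b" if "b \<in> B" for b
    using gen that unfolding generic_def by blast
  have xax: "x \<otimes> a \<otimes> x \<noteq> b" if "a \<in> B" "b \<in> B" for a b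
    using gen that unfolding generic_def by blast
  have conj: "a = \<one> \<or> comm_group G" if "a \<in> B" "x \<otimes> a \<otimes> inv x = b" "b \<in> B" for a b
    using gen that unfolding generic_def by blast
  have h1: "h \<noteq> \<one>" using h by auto
  have S: "sidon (insert x D)"
  proof (rule sidon_insert[OF D x])
    fix a b c assume "a \<in> D" "b \<in> D" "c \<in> D"
    then show "a \<otimes> inv b \<otimes> c \<noteq> x" using xB B3 AI by metis
  next
    fix b assume "b \<in> D"
    then show "x \<otimes> inv b \<otimes> x \<notin> D" using xax B1 AI by metis
  qed
  have xh: "x \<otimes> h \<in> carrier G" using x h by simp
  show ?thesis
  proof (rule sidon_insert[OF S xh])
    fix a b c
    assume mem: "a \<in> insert x D" "b \<in> insert x D" "c \<in> insert x D"
    then have C: "a \<in> carrier G" "b \<in> carrier G" "c \<in> carrier G"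
      using x car by auto
    show "a \<otimes> inv b \<otimes> c \<noteq> x \<otimes> h"
    proof
      assume eq: "a \<otimes> inv b \<otimes> c = x \<otimes> h"
      note facts = eq C x h(1)
      consider "a = b" | "b = c" | "a \<noteq> b" "b \<noteq> c" by blast
      then show False
      proof cases
        case 1
        then have xh_c: "x \<otimes> h = c" using facts by (simp add: word_simps)
        show False
        proof (cases "c = x")
          case True
          then show False using xh_c x h h1 by simp
        next
          case False
          have "x = c \<otimes> inv h" using xh_c[symmetric] x h by (simp add: word_simps)
          then show False using xB B2 AI hA False mem by auto
        qed
      next
        case 2
        then have xh_a: "x \<otimes> h = a" using facts by (simp add: word_simps)
        show False
        proof (cases "a = x")
          case True
          then show False using xh_a x h h1 by simp
        next
          case False
          have "x = a \<otimes> inv h" using xh_a[symmetric] x h by (simp add: word_simps)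
          then show False using xB B2 AI hA False mem by auto
        qed
      next
        case 3
        then consider (DDD) "a \<in> D" "b \<in> D" "c \<in> D" | (xDD) "a = x" "b \<in> D" "c \<in> D"
          | (DxD) "a \<in> D" "b = x" "c \<in> D" | (DDx) "a \<in> D" "b \<in> D" "c = x"
          | (xDx) "a = x" "b \<in> D" "c = x"
          using mem by blast
        then show False
        proof cases
          case DDD
          have "x = (a \<otimes> inv b \<otimes> c) \<otimes> inv h" unfolding eq using x h by (simp add: word_simps)
          then show False using xB B AI hA DDD by auto
        next
          case xDD
          have "inv x \<otimes> (a \<otimes> inv b \<otimes> c) = h" unfolding eq using x h by (simp add: word_simps)
          then have "h = inv b \<otimes> c" using xDD C by (simp add: word_simps)
          then show False using new xDD unfolding left_difference_def by blast
        next
          case DxD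
          have "x \<otimes> (h \<otimes> inv c) \<otimes> x = (a \<otimes> inv b \<otimes> c) \<otimes> inv c \<otimes> x"
            unfolding eq using C x h by (simp add: word_simps)
          also have "\<dots> = a" using DxD C by (simp add: word_simps)
          finally show False
            using xax[OF B2[OF hA(1) AI(2)[OF DxD(3)]] B1[OF AI(1)[OF DxD(1)]]] by simp
        next
          case DDx
          have "x \<otimes> h \<otimes> inv x = (a \<otimes> inv b \<otimes> c) \<otimes> inv x" unfolding eq ..
          also have "\<dots> = a \<otimes> inv b" using DDx C by (simp add: word_simps)
          finally have eq2: "x \<otimes> h \<otimes> inv x = a \<otimes> inv b" .
          then have "comm_group G" 
            using conj[OF B1[OF hA(1)] eq2 B2[OF AI(1)[OF DDx(1)] AI(2)[OF DDx(2)]]] h1 by simp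
          then interpret comm_group G .
          have "x \<otimes> h \<otimes> inv x = h" using x h m_comm[of x h] by (simp add: word_simps)
          then have "h = inv b \<otimes> a" using eq2 C m_comm by simp
          then show False using new DDx unfolding left_difference_def by blast
        next
          case xDx
          have "inv x \<otimes> (a \<otimes> inv b \<otimes> c) = h" unfolding eq using x h by (simp add: word_simps)
          then have "b \<otimes> h = x" using xDx C by (auto simp: word_simps)
          then show False using xB[OF B2[OF AI(1)[OF xDx(2)] hA(1)]] by simp
        qed
      qed
    qed
  next
    fix b assume "b \<in> insert x D"
    show "x \<otimes> h \<otimes> inv b \<otimes> (x \<otimes> h) \<notin> insert x D"
    proof
      assume "x \<otimes> h \<otimes> inv b \<otimes> (x \<otimes> h) \<in> insert x D"
      then obtain c where c: "c \<in> insert x D" and eq: "x \<otimes> h \<otimes> inv b \<otimes> (x \<otimes> h) = c" by blast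
      have C: "b \<in> carrier G" "c \<in> carrier G" using \<open>b \<in> insert x D\<close> c x car by auto
      show False
      proof (cases "b = x")
        case True
        then have xhh: "x \<otimes> (h \<otimes> h) = c" using eq x h by (simp add: word_simps)
        show False
        proof (cases "c = x")
          case True
          then show False using xhh x h by simp
        next
          case False
          have "x = c \<otimes> inv h \<otimes> inv h" using xhh[symmetric] x h by (simp add: word_simps)
          moreover have "c \<in> D" using False c by simp
          ultimately show False using xB[OF B3[OF AI(1) hA(2) hA(2)]] by simp
        qed
      next
        case b: False
        show False
        proof (cases "c = x")
          case True
          then have "x \<otimes> (h \<otimes> inv b \<otimes> x \<otimes> h) = x" using eq C x h by (simp add: word_simps)
          then have one: "h \<otimes> inv b \<otimes> x \<otimes> h = \<one>" using C x h by simp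
          have "x = b \<otimes> inv h \<otimes> (h \<otimes> inv b \<otimes> x \<otimes> h) \<otimes> inv h"
            using C x h by (simp add: word_simps)
          also have "\<dots> = b \<otimes> inv h \<otimes> inv h" unfolding one using C h by simp
          finally have "x = b \<otimes> inv h \<otimes> inv h" .
          moreover have "b \<in> D" using b \<open>b \<in> insert x D\<close> by simp
          ultimately show False using xB[OF B3[OF AI(1) hA(2) hA(2)]] by simp
        next
          case False
          have "x \<otimes> (h \<otimes> inv b) \<otimes> x = (x \<otimes> h \<otimes> inv b \<otimes> (x \<otimes> h)) \<otimes> inv h"
            using C x h by (simp add: word_simps)
          also have "\<dots> = c \<otimes> inv h" unfolding eq ..
          finally have "x \<otimes> (h \<otimes> inv b) \<otimes> x = c \<otimes> inv h" .
          moreover have "b \<in> D" "c \<in> D" using False b c \<open>b \<in> insert x D\<close> by auto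
          ultimately show False
            using xax[OF B2[OF hA(1) AI(2)] B2[OF AI(1) hA(2)]] by simp
        qed
      qed
    qed
  qed
qed

lemma left_difference_inv_image:
  assumes "D \<subseteq> carrier G"
  shows "left_difference h (m_inv G ` D) \<longleftrightarrow> right_difference h D"
  using assms by (fastforce simp: left_difference_def right_difference_def subset_iff)

lemma sidon_inv_image:
  assumes D: "sidon D"
  shows "sidon (m_inv G ` D)"
  unfolding sidon_def
proof (intro conjI ballI impI)
  note car = sidon_carrier[OF D]
  show "m_inv G ` D \<subseteq> carrier G" using car by auto
  fix a b c assume "a \<in> m_inv G ` D" "b \<in> m_inv G ` D" "c \<in> m_inv G ` D"
    and mem: "a \<otimes> inv b \<otimes> c \<in> m_inv G ` D"
  then obtain a' b' c' where D': "a' \<in> D" "b' \<in> D" "c' \<in> D"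
    and eqs: "a = inv a'" "b = inv b'" "c = inv c'" by blast
  obtain d where d: "d \<in> D" "a \<otimes> inv b \<otimes> c = inv d" using mem by blast
  have "c' \<otimes> inv b' \<otimes> a' = inv (a \<otimes> inv b \<otimes> c)"
    using D' car eqs by (simp add: word_simps)
  also have "\<dots> = d" using d car by simp
  finally have "c' = b' \<or> b' = a'" using sidonD[OF D, of c' b' a'] D' d by simp
  then show "a = b \<or> b = c" using eqs by auto
qed

lemma sidon_extend_left:
  assumes inf: "infinite (carrier G)"
    and gen: "\<And>B. \<lbrakk>B \<subseteq> carrier G; |B| <o |carrier G|\<rbrakk> \<Longrightarrow> \<exists>x\<in>carrier G. generic B x"
    and D: "sidon D" "|D| <o |carrier G|" and h: "h \<in> carrier G" "h \<otimes> h \<noteq> \<one>"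
  shows "\<exists>E. finite E \<and> sidon (D \<union> E) \<and> left_difference h (D \<union> E)"
proof (cases "left_difference h D")
  case True
  with D(1) show ?thesis by (intro exI[of _ "{}"]) simp
next
  case False
  define A where "A = D \<union> m_inv G ` D \<union> {\<one>, h, inv h}"
  define B where "B = (\<lambda>(p, q, r, s). p \<otimes> q \<otimes> r \<otimes> s) ` (A \<times> A \<times> A \<times> A)"
  have "|m_inv G ` D| <o |carrier G|"
    using card_of_image D(2) by (rule ordLeq_ordLess_trans)
  then have "|A| <o |carrier G|"
    unfolding A_def using D(2) inf
    by (intro card_of_Un_ordLess_infinite) (simp_all)
  then have "|B| <o |carrier G|"
    unfolding B_def by (rule product4_ordLess[OF inf])
  moreover have "A \<subseteq> carrier G"
    using sidon_carrier[OF D(1)] h by (auto simp: A_def)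
  then have "B \<subseteq> carrier G" by (auto simp: B_def)
  ultimately obtain x where x: "x \<in> carrier G" "generic B x" using gen by blast
  have B: "p \<otimes> q \<otimes> r \<otimes> s \<in> B" if "p \<in> A" "q \<in> A" "r \<in> A" "s \<in> A" for p q r s
    unfolding B_def by (rule image_eqI[of _ _ "(p, q, r, s)"]) (use that in auto)
  have "sidon (insert (x \<otimes> h) (insert x D))"
    by (rule sidon_insert_pair[OF D(1) h False x A_def B])
  moreover have "h = inv x \<otimes> (x \<otimes> h)" using x h by (simp add: word_simps)
  then have "left_difference h (insert (x \<otimes> h) (insert x D))"
    unfolding left_difference_def by blast
  ultimately show ?thesis by (intro exI[of _ "{x, x \<otimes> h}"]) (simp add: insert_commute)
qed

lemma difference_mono:
  assumes "D \<subseteq> D'"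
  shows "left_difference h D \<Longrightarrow> left_difference h D'"
    and "right_difference h D \<Longrightarrow> right_difference h D'"
  using assms unfolding left_difference_def right_difference_def by blast+

lemma inv_image_inv_image: "D \<subseteq> carrier G \<Longrightarrow> m_inv G ` m_inv G ` D = D"
  by (force simp: image_image)

text \<open>Inversion maps Sidon sets to Sidon sets and exchanges left and right differences.\<close>

lemma sidon_extend_right:
  assumes inf: "infinite (carrier G)"
    and gen: "\<And>B. \<lbrakk>B \<subseteq> carrier G; |B| <o |carrier G|\<rbrakk> \<Longrightarrow> \<exists>x\<in>carrier G. generic B x"
    and D: "sidon D" "|D| <o |carrier G|" and h: "h \<in> carrier G" "h \<otimes> h \<noteq> \<one>"
  shows "\<exists>E. finite E \<and> sidon (D \<union> E) \<and> right_difference h (D \<union> E)"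
proof -
  have "|m_inv G ` D| <o |carrier G|"
    using card_of_image D(2) by (rule ordLeq_ordLess_trans)
  from sidon_extend_left[OF inf gen sidon_inv_image[OF D(1)] this h]
  obtain E where E: "finite E" "sidon (m_inv G ` D \<union> E)" "left_difference h (m_inv G ` D \<union> E)"
    by blast
  have car: "m_inv G ` D \<union> E \<subseteq> carrier G" "D \<subseteq> carrier G"
    using E(2) D(1) unfolding sidon_def by blast+
  have eq: "m_inv G ` (m_inv G ` D \<union> E) = D \<union> m_inv G ` E"
    using inv_image_inv_image[OF car(2)] by (simp add: image_Un)
  have "sidon (D \<union> m_inv G ` E)"
    using sidon_inv_image[OF E(2)] unfolding eq .
  moreover have "right_difference h (D \<union> m_inv G ` E)"
    using E(3) left_difference_inv_image[of "D \<union> m_inv G ` E" h] inv_image_inv_image[OF car(1)]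
      \<open>sidon (D \<union> m_inv G ` E)\<close> unfolding eq sidon_def by simp
  ultimately show ?thesis using E(1) by blast
qed

text \<open>The task for \<open>h\<close> is to make \<open>h\<close> a left and a right difference. There are as many tasks as group
elements, and being a Sidon set is a condition on four elements at a time, so the transfinite greedy
construction applies.\<close>

theorem ex_sidon_all_differences:
  assumes inf: "infinite (carrier G)"
    and no_involution: "\<And>h. \<lbrakk>h \<in> carrier G; h \<otimes> h = \<one>\<rbrakk> \<Longrightarrow> h = \<one>"
    and gen: "\<And>B. \<lbrakk>B \<subseteq> carrier G; |B| <o |carrier G|\<rbrakk> \<Longrightarrow> \<exists>x\<in>carrier G. generic B x"
  shows "\<exists>D. sidon D \<and>
    (\<forall>h\<in>carrier G. h \<noteq> \<one> \<longrightarrow> left_difference h D \<and> right_difference h D)"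
proof (rule greedy_transfinite_union[OF inf])
  show "sidon {}" by (simp add: sidon_def)
next
  fix D :: "'a set"
  assume *: "\<forall>W. finite W \<longrightarrow> W \<subseteq> D \<longrightarrow> (\<exists>D'. sidon D' \<and> W \<subseteq> D')"
  show "sidon D"
    unfolding sidon_def
  proof (intro conjI ballI impI subsetI)
    fix a assume "a \<in> D"
    then obtain D' where "sidon D'" "{a} \<subseteq> D'" using *[rule_format, of "{a}"] by auto
    then show "a \<in> carrier G" using sidon_carrier by auto
  next
    fix a b c assume "a \<in> D" "b \<in> D" "c \<in> D" "a \<otimes> inv b \<otimes> c \<in> D"
    then obtain D' where D': "sidon D'" "{a, b, c, a \<otimes> inv b \<otimes> c} \<subseteq> D'"
      using *[rule_format, of "{a, b, c, a \<otimes> inv b \<otimes> c}"] by auto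
    then show "a = b \<or> b = c" using sidonD[OF D'(1), of a b c] by simp
  qed
next
  fix h and D D' :: "'a set"
  assume "h \<noteq> \<one> \<longrightarrow> left_difference h D \<and> right_difference h D" "D \<subseteq> D'"
  then show "h \<noteq> \<one> \<longrightarrow> left_difference h D' \<and> right_difference h D'"
    using difference_mono by blast
next
  fix h and D :: "'a set"
  assume h: "h \<in> carrier G" and D: "sidon D" "|D| <o |carrier G|"
  show "\<exists>E. finite E \<and> sidon (D \<union> E) \<and>
      (h \<noteq> \<one> \<longrightarrow> left_difference h (D \<union> E) \<and> right_difference h (D \<union> E))"
  proof (cases "h = \<one>")
    case True
    with D(1) show ?thesis by (intro exI[of _ "{}"]) simp
  next
    case False
    with no_involution h have hh: "h \<otimes> h \<noteq> \<one>" by blast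
    obtain E where E: "finite E" "sidon (D \<union> E)" "left_difference h (D \<union> E)"
      using sidon_extend_left[OF inf gen D h hh] by blast
    have "|D \<union> E| <o |carrier G|"
      using D(2) E(1) inf
      by (intro card_of_Un_ordLess_infinite) (simp_all)
    from sidon_extend_right[OF inf gen E(2) this h hh]
    obtain E' where E': "finite E'" "sidon (D \<union> E \<union> E')" "right_difference h (D \<union> E \<union> E')"
      by blast
    then show ?thesis
      using E difference_mono(1)[OF Un_upper1 E(3), of E']
      by (intro exI[of _ "E \<union> E'"]) (simp add: Un_assoc)
  qed
qed

end

section \<open>The plane of translates of a Sidon set\<close>

text \<open>Take two points on each of the two lines, away from their intersection. A line through three of them
would contain both points chosen on one of the two lines, hence equal that line, which contains only
two of the four points.\<close>

lemma quadrangle_of_two_infinite_lines: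
  assumes subset: "\<And>l. l \<in> L \<Longrightarrow> l \<subseteq> P"
    and uline: "\<And>x y. \<lbrakk>x \<in> P; y \<in> P; x \<noteq> y\<rbrakk> \<Longrightarrow> \<exists>!l. l \<in> L \<and> x \<in> l \<and> y \<in> l"
    and upoint: "\<And>l m. \<lbrakk>l \<in> L; m \<in> L; l \<noteq> m\<rbrakk> \<Longrightarrow> \<exists>!x. x \<in> P \<and> x \<in> l \<and> x \<in> m"
    and lm: "l \<in> L" "m \<in> L" "l \<noteq> m" and inf: "infinite l" "infinite m"
  shows "\<exists>Q \<subseteq> P. card Q = 4 \<and> (\<forall>l \<in> L. card (Q \<inter> l) \<le> 2)"
proof -
  obtain p where p: "\<And>x. x \<in> l \<Longrightarrow> x \<in> m \<Longrightarrow> x = p"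
    using upoint[OF lm] subset[OF lm(1)] by blast
  have two: "\<exists>a b. a \<in> k \<and> b \<in> k \<and> a \<noteq> b \<and> a \<noteq> p \<and> b \<noteq> p" if k: "infinite k" for k :: "'a set"
  proof -
    obtain X' where "X' \<subseteq> k - {p}" "card X' = 2"
      using infinite_arbitrarily_large[of "k - {p}" 2] k by auto
    then show ?thesis by (auto simp: card_2_iff)
  qed
  obtain a b where ab: "a \<in> l" "b \<in> l" "a \<noteq> b" "a \<noteq> p" "b \<noteq> p" using two[OF inf(1)] by blast
  obtain c d where cd: "c \<in> m" "d \<in> m" "c \<noteq> d" "c \<noteq> p" "d \<noteq> p" using two[OF inf(2)] by blast
  have not_m: "a \<notin> m" "b \<notin> m" and not_l: "c \<notin> l" "d \<notin> l" using ab cd p by blast+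
  have P: "a \<in> P" "b \<in> P" "c \<in> P" "d \<in> P" using ab cd lm subset by blast+
  have "card {a, b, c, d} = 4"
    using ab cd not_m not_l by (subst card_insert_disjoint; auto)+
  moreover have "card ({a, b, c, d} \<inter> n) \<le> 2" if n: "n \<in> L" for n
  proof -
    have line: "n = k" if "x \<in> k" "y \<in> k" "x \<in> n" "y \<in> n" "k \<in> L" "x \<noteq> y" for x y k
      using uline[of x y] that n subset[OF n] by blast
    have "\<exists>x y. {a, b, c, d} \<inter> n \<subseteq> {x, y}"
    proof (cases "n = l \<or> n = m")
      case True
      then show ?thesis using not_m not_l by blast
    next
      case False
      then have "\<not> (a \<in> n \<and> b \<in> n)" "\<not> (c \<in> n \<and> d \<in> n)"
        using line ab cd lm by blast+
      then show ?thesis by blast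
    qed
    then obtain x y where "{a, b, c, d} \<inter> n \<subseteq> {x, y}" by blast
    then have "card ({a, b, c, d} \<inter> n) \<le> card {x, y}" by (intro card_mono) auto
    also have "\<dots> \<le> 2" by (simp add: card_insert_if)
    finally show ?thesis .
  qed
  ultimately show ?thesis using P by (intro exI[of _ "{a, b, c, d}"]) simp
qed

context group
begin

definition translates :: "'a set \<Rightarrow> 'a set set" where
  "translates D = (\<lambda>g. g <# D) ` carrier G"

definition translation :: "'a \<Rightarrow> 'a \<Rightarrow> 'a" where
  "translation g = (\<lambda>x\<in>carrier G. g \<otimes> x)"

lemma mem_translate_iff:
  assumes "D \<subseteq> carrier G" "g \<in> carrier G"
  shows "x \<in> g <# D \<longleftrightarrow> x \<in> carrier G \<and> inv g \<otimes> x \<in> D"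
proof
  assume "x \<in> g <# D"
  then show "x \<in> carrier G \<and> inv g \<otimes> x \<in> D"
    using assms by (auto simp: l_coset_def word_simps subset_iff)
next
  assume "x \<in> carrier G \<and> inv g \<otimes> x \<in> D"
  then have "inv g \<otimes> x \<in> D" "x = g \<otimes> (inv g \<otimes> x)" using assms by (auto simp: word_simps)
  then show "x \<in> g <# D" unfolding l_coset_def by blast
qed

text \<open>The translate \<open>g <# D\<close> contains \<open>x\<close> and \<open>y\<close> if and only if \<open>inv g \<otimes> x\<close> and \<open>inv g \<otimes> y\<close> are elements
of \<open>D\<close>; their left difference is \<open>inv x \<otimes> y\<close>. So lines through two points correspond to
representations of \<open>inv x \<otimes> y\<close> as a left difference. Likewise \<open>g <# D\<close> and \<open>h <# D\<close> meet in
\<open>g \<otimes> a = h \<otimes> b\<close> if and only if \<open>inv g \<otimes> h = a \<otimes> inv b\<close>, so common points correspond to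
representations of \<open>inv g \<otimes> h\<close> as a right difference.\<close>

theorem projective_plane_translates:
  assumes inf: "infinite (carrier G)" and D: "sidon D"
    and all: "\<And>h. \<lbrakk>h \<in> carrier G; h \<noteq> \<one>\<rbrakk> \<Longrightarrow> left_difference h D \<and> right_difference h D"
  shows "projective_plane (carrier G) (translates D)"
proof -
  have DC: "D \<subseteq> carrier G" using D unfolding sidon_def by blast
  note mem = mem_translate_iff[OF DC]
  note car = sidon_carrier[OF D]
  have ne_one: "inv x \<otimes> y \<noteq> \<one>" if "x \<in> carrier G" "y \<in> carrier G" "x \<noteq> y" for x y
    using that by (metis inv_equality inv_inv inv_closed)
  have subset: "l \<subseteq> carrier G" if "l \<in> translates D" for l
    using that mem by (auto simp: translates_def)
  have uline: "\<exists>!l. l \<in> translates D \<and> x \<in> l \<and> y \<in> l"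
    if xy: "x \<in> carrier G" "y \<in> carrier G" "x \<noteq> y" for x y
  proof -
    have "left_difference (inv x \<otimes> y) D" using all ne_one[OF xy] xy by simp
    then obtain a b where ab: "a \<in> D" "b \<in> D" "inv x \<otimes> y = inv a \<otimes> b"
      unfolding left_difference_def by blast
    define g where "g = x \<otimes> inv a"
    have g: "g \<in> carrier G" using ab xy car by (simp add: g_def)
    have "inv g \<otimes> y = a \<otimes> (inv x \<otimes> y)" using ab(1) xy car by (simp add: g_def word_simps)
    also have "\<dots> = b" unfolding ab(3) using ab car by (simp add: word_simps)
    finally have yg: "inv g \<otimes> y = b" .
    show ?thesis
    proof (rule ex1I[of _ "g <# D"], intro conjI)
      show "g <# D \<in> translates D" using g by (auto simp: translates_def)
      show "x \<in> g <# D" using mem[OF g] ab xy car by (simp add: g_def word_simps)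
      show "y \<in> g <# D" using mem[OF g] yg xy ab by simp
    next
      fix l assume "l \<in> translates D \<and> x \<in> l \<and> y \<in> l"
      then obtain k where k: "k \<in> carrier G" "l = k <# D" "inv k \<otimes> x \<in> D" "inv k \<otimes> y \<in> D"
        using mem by (auto simp: translates_def)
      have "a \<otimes> inv (inv k \<otimes> x) \<otimes> (inv k \<otimes> y) = a \<otimes> (inv x \<otimes> y)"
        using k xy ab(1) car by (simp add: word_simps)
      also have "\<dots> = b" unfolding ab(3) using ab car by (simp add: word_simps)
      finally have "a = inv k \<otimes> x \<or> inv k \<otimes> x = inv k \<otimes> y"
        using sidonD[OF D ab(1) k(3) k(4)] ab by simp
      then have a: "a = inv k \<otimes> x" using k xy by simp
      have "g = k" unfolding g_def a using k xy by (simp add: word_simps)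
      then show "l = g <# D" using k by simp
    qed
  qed
  have upoint: "\<exists>!x. x \<in> carrier G \<and> x \<in> l \<and> x \<in> m"
    if lm: "l \<in> translates D" "m \<in> translates D" "l \<noteq> m" for l m
  proof -
    obtain g h where gh: "g \<in> carrier G" "h \<in> carrier G" "l = g <# D" "m = h <# D" "g \<noteq> h"
      using lm by (auto simp: translates_def)
    have "right_difference (inv g \<otimes> h) D" using all ne_one gh by simp
    then obtain a b where ab: "a \<in> D" "b \<in> D" "inv g \<otimes> h = a \<otimes> inv b"
      unfolding right_difference_def by blast
    have p: "h \<otimes> b \<in> carrier G" using gh ab car by simp
    have "inv g \<otimes> (h \<otimes> b) = (inv g \<otimes> h) \<otimes> b" using gh ab(2) car by (simp add: word_simps)
    also have "\<dots> = a" unfolding ab(3) using ab car by (simp add: word_simps)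
    finally have pg: "inv g \<otimes> (h \<otimes> b) = a" .
    show ?thesis
    proof (rule ex1I[of _ "h \<otimes> b"], intro conjI)
      show "h \<otimes> b \<in> carrier G" by (rule p)
      show "h \<otimes> b \<in> l" using mem[OF gh(1)] gh(3) p pg ab by simp
      show "h \<otimes> b \<in> m" using mem[OF gh(2)] gh ab car p by (simp add: word_simps)
    next
      fix x assume x: "x \<in> carrier G \<and> x \<in> l \<and> x \<in> m"
      then have xD: "inv g \<otimes> x \<in> D" "inv h \<otimes> x \<in> D" using mem gh by auto
      have "(inv g \<otimes> x) \<otimes> inv (inv h \<otimes> x) \<otimes> b = (inv g \<otimes> h) \<otimes> b"
        using x gh ab(2) car by (simp add: word_simps)
      also have "\<dots> = a" unfolding ab(3) using ab car by (simp add: word_simps)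
      finally have "inv g \<otimes> x = inv h \<otimes> x \<or> inv h \<otimes> x = b"
        using sidonD[OF D xD ab(2)] ab by simp
      moreover have "inv g \<otimes> x \<noteq> inv h \<otimes> x"
        using x gh by (metis inv_closed inv_inv r_cancel)
      ultimately have b: "b = inv h \<otimes> x" by simp
      show "x = h \<otimes> b" unfolding b using x gh by (simp add: word_simps)
    qed
  qed
  have "infinite D"
  proof
    assume "finite D"
    have "carrier G \<subseteq> insert \<one> ((\<lambda>(a, b). inv a \<otimes> b) ` (D \<times> D))"
      using all unfolding left_difference_def by force
    then show False using inf \<open>finite D\<close> by (meson finite_SigmaI finite_imageI finite_insert finite_subset)
  qed
  moreover have "inj_on ((\<otimes>) g) D" if "g \<in> carrier G" for g
    using that car by (intro inj_onI) simp
  moreover have "g <# D = (\<otimes>) g ` D" for g unfolding l_coset_def by blast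
  ultimately have inf_line: "infinite (g <# D)" if "g \<in> carrier G" for g
    using that by (simp add: finite_image_iff)
  obtain g where g: "g \<in> carrier G" "g \<noteq> \<one>"
    using inf by (metis finite.emptyI finite_insert finite_subset insert_iff subsetI)
  obtain a b where ab: "a \<in> D" "b \<in> D" "a \<noteq> b"
    using \<open>infinite D\<close> by (metis finite.emptyI finite_insert finite_subset insert_iff subsetI)
  have "\<one> <# D \<noteq> g <# D"
  proof
    assume "\<one> <# D = g <# D"
    moreover have "a \<in> \<one> <# D" "b \<in> \<one> <# D" using mem[OF one_closed] ab car by simp_all
    ultimately have "inv g \<otimes> a \<in> D" "inv g \<otimes> b \<in> D" using mem[OF g(1)] by simp_all
    moreover have "a \<otimes> inv (inv g \<otimes> a) \<otimes> (inv g \<otimes> b) = b"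
      using g ab car by (simp add: word_simps)
    ultimately have "a = inv g \<otimes> a \<or> inv g \<otimes> a = inv g \<otimes> b"
      using sidonD[OF D ab(1)] ab by simp
    then show False using g ab car by simp
  qed
  then have "\<exists>Q \<subseteq> carrier G. card Q = 4 \<and> (\<forall>l \<in> translates D. card (Q \<inter> l) \<le> 2)"
    using inf_line g by (intro quadrangle_of_two_infinite_lines[OF subset uline upoint, of "\<one> <# D" "g <# D"])
      (auto simp: translates_def)
  then show ?thesis using subset uline upoint by unfold_locales
qed

lemma translation_in_Bij: "g \<in> carrier G \<Longrightarrow> translation g \<in> Bij (carrier G)"
proof -
  assume g: "g \<in> carrier G"
  have "bij_betw (translation g) (carrier G) (carrier G)"
    by (rule bij_betw_byWitness[of _ "translation (inv g)"])
      (use g in \<open>auto simp: translation_def word_simps\<close>)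
  then show ?thesis by (simp add: Bij_def translation_def)
qed

lemma translation_mult:
  assumes "g \<in> carrier G" "h \<in> carrier G"
  shows "translation (g \<otimes> h) = compose (carrier G) (translation g) (translation h)"
  using assms by (auto simp: translation_def compose_def word_simps restrict_def)

lemma translation_image_coset:
  assumes "D \<subseteq> carrier G" "g \<in> carrier G" "h \<in> carrier G"
  shows "translation g ` (h <# D) = (g \<otimes> h) <# D"
  using assms by (force simp: translation_def l_coset_def word_simps image_iff subset_iff)

lemma translation_collineation:
  assumes D: "D \<subseteq> carrier G" and g: "g \<in> carrier G"
  shows "translation g \<in> collineations (carrier G) (translates D)"
proof -
  have "(\<lambda>l. translation g ` l) ` translates D = (\<lambda>h. (g \<otimes> h) <# D) ` carrier G"
    using translation_image_coset[OF D g] by (simp add: translates_def image_image)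
  also have "\<dots> = (\<lambda>h. h <# D) ` ((\<otimes>) g ` carrier G)" by (simp add: image_image)
  also have "(\<otimes>) g ` carrier G = carrier G"
    using g by (auto simp: image_iff) (metis inv_closed m_closed mult_inv_cancel_left(1))
  finally show ?thesis
    using translation_in_Bij[OF g] by (simp add: collineations_def translates_def)
qed

theorem translations_sharply_transitive_on_plane:
  assumes plane: "projective_plane (carrier G) (translates D)" and D: "D \<subseteq> carrier G"
  defines "H \<equiv> translation ` carrier G"
  shows "subgroup H (Aut (carrier G) (translates D))"
    and "G \<cong> (Aut (carrier G) (translates D))\<lparr>carrier := H\<rparr>"
    and "sharply_transitive H (carrier G)"
proof -
  let ?A = "Aut (carrier G) (translates D)"
  have "group ?A" by (rule projective_plane.group_Aut[OF plane])
  have hom: "translation \<in> hom G ?A"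
    by (rule homI) (simp_all add: Aut_def BijGroup_def translation_collineation[OF D]
        translation_in_Bij translation_mult)
  then have "group_hom G ?A translation"
    using \<open>group ?A\<close> by (simp add: group_hom_def group_hom_axioms_def is_group)
  then show "subgroup H ?A" unfolding H_def by (rule group_hom.img_is_subgroup)
  have apply_one: "translation g \<one> = g" if "g \<in> carrier G" for g
    using that by (simp add: translation_def)
  have "inj_on translation (carrier G)" by (rule inj_on_inverseI[of _ "\<lambda>f. f \<one>"]) (rule apply_one)
  moreover have "translation \<in> hom G (?A\<lparr>carrier := H\<rparr>)"
    using hom by (auto simp: hom_def H_def)
  ultimately have "translation \<in> iso G (?A\<lparr>carrier := H\<rparr>)"
    by (simp add: iso_def bij_betw_def H_def)
  then show "G \<cong> ?A\<lparr>carrier := H\<rparr>" by (auto simp: is_iso_def)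
  show "sharply_transitive H (carrier G)"
    unfolding sharply_transitive_def
  proof (intro ballI)
    fix x y assume xy: "x \<in> carrier G" "y \<in> carrier G"
    show "\<exists>!h. h \<in> H \<and> h x = y"
    proof (rule ex1I[of _ "translation (y \<otimes> inv x)"])
      show "translation (y \<otimes> inv x) \<in> H \<and> translation (y \<otimes> inv x) x = y"
        using xy by (simp add: H_def translation_def word_simps)
    next
      fix h assume "h \<in> H \<and> h x = y"
      then obtain g where "g \<in> carrier G" "h = translation g" "g \<otimes> x = y"
        using xy by (auto simp: H_def translation_def)
      then show "h = translation (y \<otimes> inv x)" using xy by (auto simp: word_simps)
    qed
  qed
qed

end

section \<open>Reduced words\<close>

definition flip :: "'a \<times> bool \<Rightarrow> 'a \<times> bool" where
  "flip l = (fst l, \<not> snd l)"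

definition inv_word :: "('a \<times> bool) list \<Rightarrow> ('a \<times> bool) list" where
  "inv_word w = rev (map flip w)"

abbreviation reduced :: "('a \<times> bool) list \<Rightarrow> bool" where
  "reduced \<equiv> successively (\<lambda>l m. m \<noteq> flip l)"

definition exponent_sum :: "'a \<Rightarrow> ('a \<times> bool) list \<Rightarrow> int" where
  "exponent_sum s w = (\<Sum>l\<leftarrow>w. if fst l = s then if snd l then 1 else -1 else 0)"

lemma fst_flip [simp]: "fst (flip l) = fst l"
  and flip_neq [simp]: "flip l \<noteq> l" "l \<noteq> flip l"
  by (auto simp: flip_def prod_eq_iff)

lemma reduced_words_iff: "w \<in> reduced_words S \<longleftrightarrow> fst ` set w \<subseteq> S \<and> reduced w"
proof -
  have "(\<lambda>(a, d) (b, e). \<not> (a = b \<and> d \<noteq> e)) = (\<lambda>l m. m \<noteq> flip (l :: 'a \<times> bool))"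
    by (auto simp: fun_eq_iff flip_def)
  then show ?thesis by (simp add: reduced_words_def)
qed

lemma length_inv_word [simp]: "length (inv_word w) = length w"
  and inv_word_Nil [simp]: "inv_word [] = []"
  and inv_word_append [simp]: "inv_word (u @ v) = inv_word v @ inv_word u"
  and inv_word_Cons [simp]: "inv_word (l # v) = inv_word v @ [flip l]"
  by (simp_all add: inv_word_def)

lemma exponent_sum_simps [simp]:
  "exponent_sum s [] = 0"
  "exponent_sum s (l # w) = (if fst l = s then if snd l then 1 else -1 else 0) + exponent_sum s w"
  "exponent_sum s (u @ v) = exponent_sum s u + exponent_sum s v"
  by (simp_all add: exponent_sum_def)

lemma exponent_sum_replicate [simp]:
  "exponent_sum s (replicate n (t, True)) = (if s = t then int n else 0)"
  by (induction n) auto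

lemma exponent_sum_bound: "\<bar>exponent_sum s w\<bar> \<le> int (length w)"
  by (induction w) auto

lemma exponent_sum_absent: "s \<notin> fst ` set w \<Longrightarrow> exponent_sum s w = 0"
  by (induction w) auto

lemma reduced_positive: "\<forall>l\<in>set w. snd l \<Longrightarrow> reduced w"
  unfolding successively_conv_nth flip_def by (metis Suc_lessD nth_mem snd_conv)

text \<open>The product of two reduced words is computed by cancelling a suffix \<open>c\<close> of the first against the
prefix \<open>inv_word c\<close> of the second.\<close>

lemma reduced_append_cancel:
  "\<lbrakk>reduced u; reduced v\<rbrakk> \<Longrightarrow> \<exists>u' c v'. u = u' @ c \<and> v = inv_word c @ v' \<and> reduced (u' @ v')"
proof (induction u arbitrary: v rule: rev_induct)
  case Nil
  then show ?case by auto
next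
  case (snoc l u)
  show ?case
  proof (cases "v = [] \<or> hd v \<noteq> flip l")
    case True
    then have "reduced ((u @ [l]) @ v)"
      using snoc.prems by (auto simp: successively_append_iff successively_Cons)
    then show ?thesis by (intro exI[of _ "u @ [l]"] exI[of _ "[]"] exI[of _ v]) simp
  next
    case False
    then obtain w where v: "v = flip l # w" by (cases v) auto
    have "reduced u" "reduced w"
      using snoc.prems v by (auto simp: successively_append_iff successively_Cons)
    from snoc.IH[OF this] obtain u' c v' where
      "u = u' @ c" "w = inv_word c @ v'" "reduced (u' @ v')" by blast
    then show ?thesis
      using v by (intro exI[of _ u'] exI[of _ "c @ [l]"] exI[of _ v']) simp
  qed
qed

text \<open>Look at the middle of the word: in odd length the middle letter would be its own inverse, in even
length the two middle letters would be inverse to each other, against reducedness.\<close>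

lemma reduced_self_inverse:
  assumes red: "reduced w" and self: "w = inv_word w"
  shows "w = []"
proof (rule ccontr)
  assume "w \<noteq> []"
  define i where "i = length w div 2"
  have i: "i < length w" using \<open>w \<noteq> []\<close> by (simp add: i_def)
  have nth: "w ! i = flip (w ! (length w - Suc i))"
    using i by (subst self) (simp add: inv_word_def rev_nth)
  show False
  proof (cases "even (length w)")
    case True
    then obtain j where j: "i = Suc j" "length w - Suc i = j"
      using \<open>w \<noteq> []\<close> by (cases i) (auto simp: i_def elim!: evenE)
    then have "w ! Suc j \<noteq> flip (w ! j)"
      using red i by (simp add: successively_conv_nth)
    with nth j show False by simp
  next
    case False
    then have "length w - Suc i = i" by (auto simp: i_def elim!: oddE)
    with nth show False by (metis flip_neq(2))
  qed
qed

context group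
begin

lemma letter_val_closed: "fst l \<in> carrier G \<Longrightarrow> letter_val G l \<in> carrier G"
  by (simp add: letter_val_def)

lemma letter_val_flip: "fst l \<in> carrier G \<Longrightarrow> letter_val G (flip l) = inv (letter_val G l)"
  by (simp add: letter_val_def flip_def)

lemma word_val_simps [simp]:
  "word_val G [] = \<one>" "word_val G (l # w) = letter_val G l \<otimes> word_val G w"
  by (simp_all add: word_val_def)

lemma word_val_closed: "fst ` set w \<subseteq> carrier G \<Longrightarrow> word_val G w \<in> carrier G"
  by (induction w) (auto simp: letter_val_closed)

lemma word_val_append:
  "\<lbrakk>fst ` set u \<subseteq> carrier G; fst ` set v \<subseteq> carrier G\<rbrakk>
    \<Longrightarrow> word_val G (u @ v) = word_val G u \<otimes> word_val G v"
  by (induction u) (auto simp: letter_val_closed word_val_closed m_assoc)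

lemma word_val_inv_word:
  "fst ` set w \<subseteq> carrier G \<Longrightarrow> word_val G (inv_word w) = inv (word_val G w)"
  by (induction w)
    (auto simp: word_val_append word_val_closed letter_val_closed letter_val_flip inv_mult_group
      inv_word_def image_subset_iff)

lemma word_val_cancel:
  assumes "fst ` set (u @ c @ v) \<subseteq> carrier G"
  shows "word_val G (u @ v) = word_val G (u @ c) \<otimes> word_val G (inv_word c @ v)"
proof -
  have "fst ` set (inv_word c) \<subseteq> carrier G" using assms by (auto simp: inv_word_def)
  then show ?thesis
    using assms by (simp add: word_val_append word_val_inv_word word_val_closed word_simps image_Un)
qed

text \<open>That reduction also preserves exponent sums makes the exponent sum of a basis element well defined
on group elements, and a homomorphism to the integers.\<close>

lemma ex_reduced_word:
  assumes "fst ` set w \<subseteq> S" "S \<subseteq> carrier G"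
  shows "\<exists>v\<in>reduced_words S. word_val G v = word_val G w \<and>
           (\<forall>s. exponent_sum s v = exponent_sum s w)"
  using assms(1)
proof (induction w)
  case Nil
  show ?case by (intro bexI[of _ "[]"]) (simp_all add: reduced_words_iff)
next
  case (Cons l w)
  then obtain v where v: "v \<in> reduced_words S" "word_val G v = word_val G w"
    "\<And>s. exponent_sum s v = exponent_sum s w" by auto
  have l: "fst l \<in> S" "fst l \<in> carrier G" using Cons.prems assms(2) by auto
  show ?case
  proof (cases "v \<noteq> [] \<and> hd v = flip l")
    case False
    then have "l # v \<in> reduced_words S"
      using v(1) l by (auto simp: reduced_words_iff successively_Cons)
    with v show ?thesis by (intro bexI[of _ "l # v"]) simp_all
  next
    case True
    then obtain v' where v': "v = flip l # v'" by (cases v) auto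
    have red: "v' \<in> reduced_words S"
      using v(1) v' by (auto simp: reduced_words_iff successively_Cons)
    then have "fst ` set v' \<subseteq> carrier G" using assms(2) by (auto simp: reduced_words_iff)
    then have "word_val G v' = word_val G (l # w)"
      using v(2)[symmetric] v' l
      by (simp add: letter_val_flip letter_val_closed word_val_closed word_simps)
    moreover have "exponent_sum s v' = exponent_sum s (l # w)" for s
      using v(3)[of s, symmetric] v' by (auto simp: flip_def)
    ultimately show ?thesis using red by blast
  qed
qed

end

section \<open>Generic elements of free groups\<close>

locale free_on = group G for G (structure) +
  fixes S :: "'a set"
  assumes basis: "free_basis G S"
begin

lemma basis_subset: "S \<subseteq> carrier G"
  using basis by (simp add: free_basis_def)

definition word :: "'a \<Rightarrow> ('a \<times> bool) list" where
  "word g = the_inv_into (reduced_words S) (word_val G) g"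

definition exponent :: "'a \<Rightarrow> 'a \<Rightarrow> int" where
  "exponent s g = exponent_sum s (word g)"

lemma word_reduced: "g \<in> carrier G \<Longrightarrow> word g \<in> reduced_words S"
  and word_val_word: "g \<in> carrier G \<Longrightarrow> word_val G (word g) = g"
  using basis
  by (auto simp: free_basis_def word_def bij_betw_def intro: the_inv_into_into f_the_inv_into_f)

lemma letters_word: "g \<in> carrier G \<Longrightarrow> fst ` set (word g) \<subseteq> S"
  using word_reduced by (simp add: reduced_words_iff)

lemma reduced_words_eqI:
  "\<lbrakk>u \<in> reduced_words S; v \<in> reduced_words S; word_val G u = word_val G v\<rbrakk> \<Longrightarrow> u = v"
  using basis by (auto simp: free_basis_def bij_betw_def dest: inj_onD)

lemma word_val_closed_basis: "fst ` set w \<subseteq> S \<Longrightarrow> word_val G w \<in> carrier G"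
  using word_val_closed basis_subset by blast

lemma word_val_append_basis:
  "\<lbrakk>fst ` set u \<subseteq> S; fst ` set v \<subseteq> S\<rbrakk> \<Longrightarrow> word_val G (u @ v) = word_val G u \<otimes> word_val G v"
  using word_val_append basis_subset by (meson subset_trans)

lemma exponent_word_val:
  assumes "fst ` set w \<subseteq> S"
  shows "exponent s (word_val G w) = exponent_sum s w"
proof -
  obtain v where v: "v \<in> reduced_words S" "word_val G v = word_val G w"
    "\<forall>s. exponent_sum s v = exponent_sum s w"
    using ex_reduced_word[OF assms basis_subset] by blast
  have "word (word_val G w) = v"
    using v word_reduced word_val_word word_val_closed_basis[OF assms] by (intro reduced_words_eqI) auto
  with v(3) show ?thesis by (simp add: exponent_def)
qed

lemma exponent_mult:
  assumes "g \<in> carrier G" "h \<in> carrier G"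
  shows "exponent s (g \<otimes> h) = exponent s g + exponent s h"
proof -
  have "g \<otimes> h = word_val G (word g @ word h)"
    using assms letters_word by (simp add: word_val_append_basis word_val_word)
  then show ?thesis
    using assms letters_word exponent_word_val[of "word g @ word h" s]
    by (simp add: exponent_def image_Un)
qed

lemma reduced_word_mult:
  assumes u: "u \<in> reduced_words S" and v: "v \<in> reduced_words S"
  shows "\<exists>u' c v'. u = u' @ c \<and> v = inv_word c @ v' \<and> u' @ v' \<in> reduced_words S \<and>
           word_val G (u' @ v') = word_val G u \<otimes> word_val G v"
proof -
  obtain u' c v' where eq: "u = u' @ c" "v = inv_word c @ v'" and red: "reduced (u' @ v')"
    using reduced_append_cancel[of u v] u v by (auto simp: reduced_words_iff)
  have "fst ` set (u' @ c @ v') \<subseteq> S" using u v eq by (auto simp: reduced_words_iff)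
  then show ?thesis
    using red eq word_val_cancel[of u' c v'] basis_subset
    by (intro exI[of _ u'] exI[of _ c] exI[of _ v']) (auto simp: reduced_words_iff)
qed

text \<open>If \<open>g \<otimes> g = \<one>\<close>, the two copies of the reduced word of \<open>g\<close> cancel completely, so that word is its
own formal inverse.\<close>

theorem no_involution:
  assumes g: "g \<in> carrier G" and gg: "g \<otimes> g = \<one>"
  shows "g = \<one>"
proof -
  have w: "word g \<in> reduced_words S" by (rule word_reduced[OF g])
  obtain u c v where eq: "word g = u @ c" "word g = inv_word c @ v" "u @ v \<in> reduced_words S"
    and val: "word_val G (u @ v) = \<one>"
    using reduced_word_mult[OF w w] gg by (auto simp: word_val_word[OF g])
  have "u @ v = []"
    using reduced_words_eqI[OF eq(3), of "[]"] val by (simp add: reduced_words_iff)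
  then have "word g = inv_word (word g)" "reduced (word g)" using eq w by (auto simp: reduced_words_iff)
  then have "word g = []" by (rule reduced_self_inverse[rotated])
  then show ?thesis using word_val_word[OF g] by simp
qed

lemma positive_in_reduced_words:
  "\<lbrakk>fst ` set w \<subseteq> S; \<forall>l\<in>set w. snd l\<rbrakk> \<Longrightarrow> w \<in> reduced_words S"
  by (simp add: reduced_words_iff reduced_positive)

lemma infinite_carrier:
  assumes "s \<in> S"
  shows "infinite (carrier G)"
proof -
  let ?f = "\<lambda>n. word_val G (replicate n (s, True))"
  have letters: "fst ` set (replicate n (s, True)) \<subseteq> S" for n using assms by auto
  have "inj ?f"
    by (rule inj_on_inverseI[of _ "\<lambda>g. nat (exponent s g)"])
      (simp add: exponent_word_val[OF letters])
  moreover have "range ?f \<subseteq> carrier G" using letters word_val_closed_basis by auto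
  ultimately show ?thesis using finite_subset finite_imageD infinite_UNIV_nat by metis
qed

lemma basis_nonempty:
  assumes "carrier G \<noteq> {\<one>}"
  shows "S \<noteq> {}"
proof
  assume "S = {}"
  have "g = \<one>" if "g \<in> carrier G" for g
    using letters_word[OF that] word_val_word[OF that] \<open>S = {}\<close> by simp
  then show False using assms one_closed by blast
qed

text \<open>If the elements of the infinite set \<open>B\<close> involved all basis elements, then the basis would have at
most \<open>|B|\<close> elements, and so would the set of all words over it, hence the whole group.\<close>

lemma ex_fresh_letter:
  assumes B: "B \<subseteq> carrier G" "infinite B" and less: "|B| <o |carrier G|"
  shows "\<exists>t\<in>S. \<forall>b\<in>B. t \<notin> fst ` set (word b)"
proof (rule ccontr)
  assume "\<not> ?thesis"
  then have "S \<subseteq> (\<Union>b\<in>B. fst ` set (word b))" by blast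
  then have "|S| \<le>o |\<Union>b\<in>B. fst ` set (word b)|" by (rule card_of_mono1)
  also have "|\<Union>b\<in>B. fst ` set (word b)| \<le>o |B|"
    using B(2) by (intro card_of_UNION_ordLeq_infinite)
      (auto intro: ordLess_imp_ordLeq finite_ordLess_infinite2)
  finally have "|S| \<le>o |B|" .
  then have "|S \<times> (UNIV :: bool set)| \<le>o |B|"
    using B(2) by (intro card_of_Times_ordLeq_infinite_Field)
      (auto intro: ordLess_imp_ordLeq finite_ordLess_infinite2)
  then have "|lists (S \<times> (UNIV :: bool set))| \<le>o |lists B|" by (rule card_of_lists_mono)
  also have "|lists B| =o |B|" using B(2) by (rule card_of_lists_infinite)
  finally have words: "|lists (S \<times> (UNIV :: bool set))| \<le>o |B|" .
  have "carrier G \<subseteq> word_val G ` lists (S \<times> UNIV)"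
  proof
    fix g assume g: "g \<in> carrier G"
    have "word g \<in> lists (S \<times> UNIV)" using letters_word[OF g] by force
    then show "g \<in> word_val G ` lists (S \<times> UNIV)" using word_val_word[OF g] by force
  qed
  then have "|carrier G| \<le>o |word_val G ` lists (S \<times> UNIV)|" by (rule card_of_mono1)
  also have "|word_val G ` lists (S \<times> UNIV)| \<le>o |lists (S \<times> (UNIV :: bool set))|" by (rule card_of_image)
  finally have "|carrier G| \<le>o |B|" using words by (rule ordLeq_transitive)
  with less show False by (simp add: not_ordLess_ordLeq)
qed

text \<open>The homomorphism \<open>exponent s\<close> takes so large a value at \<open>x\<close> that it refutes the first two equations
in the notion of genericity.\<close>

lemma generic_of_exponent:
  assumes B: "B \<subseteq> carrier G" and x: "x \<in> carrier G"
    and small: "\<And>b. b \<in> B \<Longrightarrow> \<bar>exponent s b\<bar> < exponent s x"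
    and conj: "\<And>a b. \<lbrakk>a \<in> B; b \<in> B; x \<otimes> a = b \<otimes> x\<rbrakk> \<Longrightarrow> a = \<one> \<or> comm_group G"
  shows "generic B x"
  unfolding generic_def
proof (intro conjI ballI impI)
  show "x \<notin> B" using small by force
next
  fix a assume a: "a \<in> B"
  have "exponent s (x \<otimes> a \<otimes> x) = 2 * exponent s x + exponent s a"
    using a B x by (auto simp: exponent_mult)
  then show "x \<otimes> a \<otimes> x \<notin> B" using small[OF a] small[of "x \<otimes> a \<otimes> x"] by force
next
  fix a assume a: "a \<in> B" "x \<otimes> a \<otimes> inv x \<in> B"
  have "x \<otimes> a = (x \<otimes> a \<otimes> inv x) \<otimes> x" using a B x by (auto simp: m_assoc)
  with conj a show "a = \<one> \<or> comm_group G" by blast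
qed

text \<open>In an equation \<open>t \<otimes> a = b \<otimes> t\<close> both sides are already reduced when \<open>t\<close> occurs in neither \<open>a\<close> nor
\<open>b\<close>; comparing the first letters forces \<open>b\<close>, and then \<open>a\<close>, to be trivial.\<close>

lemma generic_fresh_letter:
  assumes B: "B \<subseteq> carrier G" and t: "t \<in> S" and fresh: "\<And>b. b \<in> B \<Longrightarrow> t \<notin> fst ` set (word b)"
  shows "generic B t"
proof (rule generic_of_exponent[OF B, of _ t])
  have tC: "t \<in> carrier G" using t basis_subset by blast
  then show "t \<in> carrier G" .
  have val: "word_val G [(t, True)] = t" using tC by (simp add: letter_val_def)
  have "exponent t t = 1"
    using exponent_word_val[of "[(t, True)]" t] t unfolding val by simp
  then show "\<bar>exponent t b\<bar> < exponent t t" if "b \<in> B" for b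
    using exponent_sum_absent[OF fresh[OF that]] by (simp add: exponent_def)
  fix a b assume a: "a \<in> B" and b: "b \<in> B" and eq: "t \<otimes> a = b \<otimes> t"
  have C: "a \<in> carrier G" "b \<in> carrier G" using a b B by auto
  have avoid: "fst l \<noteq> t" if "l \<in> set (word a) \<union> set (word b)" for l
    using that fresh a b by blast
  have 1: "(t, True) # word a \<in> reduced_words S"
    using word_reduced[OF C(1)] t avoid[of "hd (word a)"]
    by (cases "word a") (auto simp: reduced_words_iff successively_Cons flip_def)
  have 2: "word b @ [(t, True)] \<in> reduced_words S"
    using word_reduced[OF C(2)] t avoid[of "last (word b)"]
    by (cases "word b" rule: rev_cases) (auto simp: reduced_words_iff successively_append_iff flip_def)
  have "word_val G ((t, True) # word a) = t \<otimes> a"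
    using tC C by (simp add: letter_val_def word_val_word)
  moreover have "word_val G (word b @ [(t, True)]) = b \<otimes> t"
    using word_val_append_basis[OF letters_word[OF C(2)], of "[(t, True)]"] t tC C
    by (simp add: letter_val_def word_val_word)
  ultimately have "(t, True) # word a = word b @ [(t, True)]"
    using 1 2 eq by (intro reduced_words_eqI) simp_all
  then have "word b = []" "word a = []"
    using avoid[of "hd (word b)"] by (cases "word b"; auto)+
  then show "a = \<one> \<or> comm_group G" using word_val_word[OF C(1)] by simp
qed

text \<open>Let \<open>x\<close> be the block of \<open>N\<close> letters \<open>p\<close> followed by \<open>N\<close> letters \<open>q\<close>. Fewer than \<open>N\<close> letters cancel on
either side of \<open>x \<otimes> a = b \<otimes> x\<close>, so the step from \<open>p\<close> to \<open>q\<close> in the middle of \<open>x\<close> survives in both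
reduced products. On the left it stays at its place, on the right it is shifted by the difference of
the lengths of the part of \<open>b\<close> that survives and the part that cancels. These lengths therefore agree,
and then both products are \<open>x\<close> itself.\<close>

lemma positive_block_shift:
  assumes pq: "p \<in> S" "q \<in> S" "p \<noteq> q"
    and a: "a \<in> reduced_words S" "length a < N" and b: "b \<in> reduced_words S" "length b < N"
  defines "x \<equiv> replicate N (p, True) @ replicate N (q, True)"
  assumes eq: "word_val G x \<otimes> word_val G a = word_val G b \<otimes> word_val G x"
  shows "a = []"
proof -
  have x: "x \<in> reduced_words S"
    using pq by (intro positive_in_reduced_words) (auto simp: x_def)
  have x_nth: "x ! n = (if n < N then (p, True) else (q, True))" if "n < 2 * N" for n
    using that by (simp add: x_def nth_append)
  have len: "length x = 2 * N" by (simp add: x_def)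
  obtain x1 c a1 where 1: "x = x1 @ c" "a = inv_word c @ a1" "x1 @ a1 \<in> reduced_words S"
    "word_val G (x1 @ a1) = word_val G x \<otimes> word_val G a"
    using reduced_word_mult[OF x a(1)] by blast
  obtain b1 d x2 where 2: "b = b1 @ d" "x = inv_word d @ x2" "b1 @ x2 \<in> reduced_words S"
    "word_val G (b1 @ x2) = word_val G b \<otimes> word_val G x"
    using reduced_word_mult[OF b(1) x] by blast
  \<comment> \<open>Both sides of the equation have the same reduced word, called y.\<close>
  define y where "y = x1 @ a1"
  have y: "y = b1 @ x2" unfolding y_def using 1 2 eq by (intro reduced_words_eqI) simp_all
  have lens: "length c < N" "length d < N" "length b1 + length d < N"
    using a b 1(2) 2(1) by auto
  have len1: "length x1 = 2 * N - length c" and len2: "length x2 = 2 * N - length d"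
    using len arg_cong[OF 1(1), of length] arg_cong[OF 2(2), of length] by auto
  have left: "y ! n = x ! n" if "n < 2 * N - length c" for n
    using that len1 1(1) by (simp add: y_def nth_append)
  have right: "y ! (length b1 + n) = x ! (length d + n)" for n
    unfolding y using 2(2) by (simp add: nth_append)
  have "length b1 = length d"
  proof (rule ccontr)
    assume "length b1 \<noteq> length d"
    then consider "length d < length b1" | "length b1 < length d" by linarith
    then show False
    proof cases
      case 1
      \<comment> \<open>The surviving part of b is too long: position N of y is the first q of
        the left copy of x but still a p of the right copy.\<close>
      have "x ! N = x ! (length d + (N - length b1))"
        using left[of N] right[of "N - length b1"] lens by simp
      moreover have "length d + (N - length b1) < N" using 1 lens by linarith
      ultimately show False
        using x_nth[of N] x_nth[of "length d + (N - length b1)"] lens pq by simp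
    next
      case 2
      \<comment> \<open>The surviving part of b is too short: position N - 1 of y is the last p
        of the left copy of x but already a q of the right copy.\<close>
      have "x ! (N - 1) = x ! (length d + (N - 1 - length b1))"
        using left[of "N - 1"] right[of "N - 1 - length b1"] lens by simp
      moreover have "N \<le> length d + (N - 1 - length b1)" "length d + (N - 1 - length b1) < 2 * N"
        using 2 lens by linarith+
      ultimately show False
        using x_nth[of "N - 1"] x_nth[of "length d + (N - 1 - length b1)"] lens pq by simp
    qed
  qed
  then have "b1 = take (length d) y" "inv_word d = take (length d) x" 
    using y 2(2) by auto
  moreover have "take (length d) y = take (length d) x"
    using left lens len1 len 1(1) by (simp add: y_def)
  ultimately have "y = x" using y 2(2) by simp
  then have "word_val G x \<otimes> word_val G a = word_val G x" using 1(4) y_def by simp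
  then have "word_val G a = word_val G []"
    using x a(1) word_val_closed_basis by (simp add: reduced_words_iff)
  then show ?thesis using a(1) by (intro reduced_words_eqI) (simp_all add: reduced_words_iff)
qed

lemma comm_group_rank_one:
  assumes "S = {s}"
  shows "comm_group G"
proof -
  have s: "s \<in> carrier G" using basis_subset assms by blast
  have pow: "word_val G w = s [^] exponent_sum s w" if "fst ` set w \<subseteq> S" for w
    using that
  proof (induction w)
    case (Cons l w)
    have "letter_val G l = s [^] (if snd l then 1 else -1 :: int)"
      using Cons.prems assms s int_pow_neg[of s 1] by (auto simp: letter_val_def)
    then show ?case using Cons assms s by (auto simp: int_pow_mult)
  qed simp
  have cyclic: "g = s [^] exponent s g" if "g \<in> carrier G" for g
    using pow[of "word g"] letters_word[OF that] word_val_word[OF that]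
    by (simp add: exponent_def)
  show ?thesis
  proof (rule group_comm_groupI)
    fix g h assume "g \<in> carrier G" "h \<in> carrier G"
    then have "g = s [^] exponent s g" "h = s [^] exponent s h" using cyclic by auto
    then show "g \<otimes> h = h \<otimes> g" using s by (metis add.commute int_pow_mult)
  qed
qed

text \<open>In rank one a high power of the generator is generic, because the group is commutative. In rank at
least two the block of length \<open>2 * N\<close> is, where \<open>N\<close> exceeds the lengths of all elements of \<open>B\<close>.\<close>

lemma ex_generic_finite:
  assumes B: "B \<subseteq> carrier G" "finite B" and S: "S \<noteq> {}"
  shows "\<exists>x\<in>carrier G. generic B x"
proof -
  obtain p where p: "p \<in> S" using S by blast
  define N where "N = Suc (Max (insert 0 ((\<lambda>b. length (word b)) ` B)))"
  have N: "length (word b) < N" if "b \<in> B" for b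
    using B(2) that by (simp add: N_def less_Suc_eq_le)
  have small: "\<bar>exponent p b\<bar> < int N" if "b \<in> B" for b
    using exponent_sum_bound[of p "word b"] N[OF that] by (simp add: exponent_def)
  \<comment> \<open>The case q = p is allowed only in rank one.\<close>
  obtain q where q: "q \<in> S" "q = p \<longrightarrow> S = {p}" using p by blast
  show ?thesis
  proof (cases "q = p")
    case True
    let ?w = "replicate N (p, True)"
    have w: "fst ` set ?w \<subseteq> S" using p by auto
    have "generic B (word_val G ?w)"
      using B(1) small word_val_closed_basis[OF w] exponent_word_val[OF w, of p]
        comm_group_rank_one[of p] True q
      by (intro generic_of_exponent[of _ _ p]) auto
    then show ?thesis using word_val_closed_basis[OF w] by blast
  next
    case False
    let ?w = "replicate N (p, True) @ replicate N (q, True)"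
    have w: "fst ` set ?w \<subseteq> S" using p q by auto
    have "generic B (word_val G ?w)"
    proof (rule generic_of_exponent[of _ _ p])
      fix b assume "b \<in> B"
      then show "\<bar>exponent p b\<bar> < exponent p (word_val G ?w)"
        using small exponent_word_val[OF w, of p] False by simp
    next
      fix a b assume ab: "a \<in> B" "b \<in> B"
        and eq: "word_val G ?w \<otimes> a = b \<otimes> word_val G ?w"
      have C: "a \<in> carrier G" "b \<in> carrier G" using ab B by auto
      have "word a = []"
        by (rule positive_block_shift[of p q _ N "word b"])
          (use p q False C ab N word_reduced word_val_word eq in auto)
      then show "a = \<one> \<or> comm_group G" using word_val_word[OF C(1)] by simp
    qed (use B word_val_closed_basis[OF w] in auto)
    then show ?thesis using word_val_closed_basis[OF w] by blast
  qed
qed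

theorem ex_generic:
  assumes "S \<noteq> {}" "B \<subseteq> carrier G" "|B| <o |carrier G|"
  shows "\<exists>x\<in>carrier G. generic B x"
proof (cases "finite B")
  case True
  with ex_generic_finite assms show ?thesis by blast
next
  case False
  obtain t where "t \<in> S" "\<forall>b\<in>B. t \<notin> fst ` set (word b)"
    using ex_fresh_letter[OF assms(2) False assms(3)] by blast
  then show ?thesis
    using generic_fresh_letter[OF assms(2)] basis_subset by blast
qed

end

section \<open>A plane with a sharply transitive free group\<close>

theorem theorem1p2:
  fixes F :: "('g, 'm) monoid_scheme"
  assumes "free_group F"
    and nontrivial: "carrier F \<noteq> {\<one>\<^bsub>F\<^esub>}"
  shows "\<exists>(P :: 'g set) (L :: 'g set set) (H :: ('g \<Rightarrow> 'g) set).
           projective_plane P L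
         \<and> subgroup H (Aut P L)
         \<and> F \<cong> (Aut P L)\<lparr>carrier := H\<rparr>
         \<and> sharply_transitive H P"
proof -
  interpret free_group F by (rule assms(1))
  obtain S where "free_basis F S" using ex_free_basis by blast
  then interpret free_on F S by unfold_locales
  have S: "S \<noteq> {}" by (rule basis_nonempty[OF nontrivial])
  then have inf: "infinite (carrier F)" using infinite_carrier by blast
  obtain D where D: "sidon D" and all: "\<And>h. \<lbrakk>h \<in> carrier F; h \<noteq> \<one>\<^bsub>F\<^esub>\<rbrakk> \<Longrightarrow>
      left_difference h D \<and> right_difference h D"
    using ex_sidon_all_differences[OF inf no_involution ex_generic[OF S]] by blast
  have plane: "projective_plane (carrier F) (translates D)"
    by (rule projective_plane_translates[OF inf D all])
  have "D \<subseteq> carrier F" using D by (simp add: sidon_def)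
  from translations_sharply_transitive_on_plane[OF plane this] plane
  show ?thesis by blast
qed

end
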